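(* Let $(\xi_k^x)_{k\ge1}$ and $(\xi_k^y)_{k\ge1}$ be independent sequences of i.i.d. non-negative integer-valued random variables, with associated environment $\Xi$. Assume that for all $\varepsilon\in(0,1-p_c]$, $$\mathbb{P}^{\Xi}_{p_c+\varepsilon,\,p_c}(o\longleftrightarrow\infty)>0\quad\text{for }\mu_\xi\text{-almost every }\Xi.$$ Then, for all $\phi\in(0,1]$ and $\tilde\varepsilon\in(0,1-p_c]$, $$\mathbb{P}^{\Xi_\phi}_{p_c+\tilde\varepsilon,\,p_c}(o\longleftrightarrow\infty)>0\quad\text{for }(\mu_\xi\times\nu_\phi)\text{-almost every }\Xi_\phi.$$
   Context: $\mathbb{Z}_+=\{0,1,2,\dots\}$, and $\mathbb{L}^2_+$ is the nearest-neighbour square lattice restricted to the first quadrant, with vertex set $\mathbb{Z}_+^2$ and origin $o=(0,0)$. Random environment: the spacings define the selected columns $\mathcal{C}=\{0\}\cup\{\sum_{k=1}^m\xi_k^x: m\ge1\}$, the selected rows $\mathcal{R}=\{0\}\cup\{\sum_{k=1}^m\xi_k^y: m\ge1\}$, and the environment $\Xi=\mathcal{C}\times\mathcal{R}\subset\mathbb{Z}_+^2$. $\mu_\xi$ denotes the law of the environment, i.e. the product of the law of $\mathcal{C}$ and the law of $\mathcal{R}$. Diluted environment: for $\phi\in[0,1]$, let $(\mathcal{D}_v)_{v\in\mathbb{Z}_+^2}$ be i.i.d. Bernoulli random variables of parameter $\phi$, with product law $\nu_\phi$, independent of $\Xi$; set $\Xi_\phi=\{v\in\Xi:\mathcal{D}_v=1\}$.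 Percolation: for a fixed set $A\subset\mathbb{Z}_+^2$ (here $A=\Xi$ or $A=\Xi_\phi$) and $p,q\in[0,1]$, $\mathbb{P}^{A}_{p,q}$ is the product measure on $\{0,1\}^{\mathbb{Z}_+^2}$ under which the $\omega(v)$, $v\in\mathbb{Z}_+^2$, are independent, with $\omega(v)=1$ ($v$ open) with probability $p$ if $v\in A$ and with probability $q$ if $v\notin A$. A path (sequence of distinct successively adjacent vertices) is open if all its vertices are open. $\{o\longleftrightarrow\infty\}$ is the event that there is an unbounded sequence of vertices of $\mathbb{Z}_+^2$ each connected to $o$ by an open path. $p_c$ is the critical threshold of homogeneous Bernoulli site percolation on $\mathbb{L}^2_+$. *)

theory Defs
  imports "HOL-Probability.Probability"
begin

type_synonym vertex = "nat \<times> nat"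

section \<open>Percolation on the first quadrant\<close>

definition adjacent :: "vertex \<Rightarrow> vertex \<Rightarrow> bool" where
  "adjacent u v \<longleftrightarrow>
     \<bar>int (fst u) - int (fst v)\<bar> + \<bar>int (snd u) - int (snd v)\<bar> = 1"

definition lattice_path :: "vertex list \<Rightarrow> bool" where
  "lattice_path vs \<longleftrightarrow> vs \<noteq> [] \<and> distinct vs \<and> successively adjacent vs"

definition connected_in :: "(vertex \<Rightarrow> bool) \<Rightarrow> vertex \<Rightarrow> vertex \<Rightarrow> bool" where
  "connected_in \<omega> u v \<longleftrightarrow>
     (\<exists>vs. lattice_path vs \<and> hd vs = u \<and> last vs = v \<and> (\<forall>w\<in>set vs. \<omega> w))"

definition origin_to_infinity :: "(vertex \<Rightarrow> bool) set" where
  "origin_to_infinity =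
     {\<omega>. \<exists>x :: nat \<Rightarrow> vertex. \<not> bounded (range x) \<and> (\<forall>n. connected_in \<omega> (0, 0) (x n))}"

definition percolation_measure ::
    "vertex set \<Rightarrow> real \<Rightarrow> real \<Rightarrow> (vertex \<Rightarrow> bool) measure" where
  "percolation_measure A p q =
     PiM UNIV (\<lambda>v. measure_pmf (bernoulli_pmf (if v \<in> A then p else q)))"

definition percolation_prob :: "vertex set \<Rightarrow> real \<Rightarrow> real \<Rightarrow> real" where
  "percolation_prob A p q = measure (percolation_measure A p q) origin_to_infinity"

text \<open>In the homogeneous model all sites have parameter \<open>p\<close>, so the choice of \<open>A\<close> is immaterial.\<close>

definition p_crit :: real where
  "p_crit = Sup {p \<in> {0..1}. percolation_prob {} p p = 0}"


section \<open>Random and diluted environments\<close>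

text \<open>The \<open>\<sigma>\<close>-algebra on subsets of \<open>'b\<close> generated by the events \<open>v \<in> A\<close>.\<close>

definition subset_space :: "'b set measure" where
  "subset_space = sigma UNIV (range (\<lambda>v. {A. v \<in> A}))"

text \<open>Spacings are indexed from 1; the value at index 0 is never used.\<close>

definition selected :: "(nat \<Rightarrow> nat) \<Rightarrow> nat set" where
  "selected s = {0} \<union> {\<Sum>k=1..m. s k | m. m \<ge> 1}"

definition iid_spacings :: "'a measure \<Rightarrow> (nat \<Rightarrow> 'a \<Rightarrow> nat) \<Rightarrow> bool" where
  "iid_spacings M \<xi> \<longleftrightarrow>
     prob_space.indep_vars M (\<lambda>_. count_space UNIV) \<xi> {1..} \<and>
     (\<forall>k\<ge>1. distr M (count_space UNIV) (\<xi> k) = distr M (count_space UNIV) (\<xi> 1))"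

definition indep_spacings ::
    "'a measure \<Rightarrow> (nat \<Rightarrow> 'a \<Rightarrow> nat) \<Rightarrow> (nat \<Rightarrow> 'a \<Rightarrow> nat) \<Rightarrow> bool" where
  "indep_spacings M \<xi> \<eta> \<longleftrightarrow>
     prob_space.indep_var M
       (PiM {1..} (\<lambda>_. count_space UNIV)) (\<lambda>w. \<lambda>k\<in>{1..}. \<xi> k w)
       (PiM {1..} (\<lambda>_. count_space UNIV)) (\<lambda>w. \<lambda>k\<in>{1..}. \<eta> k w)"

definition selected_law :: "'a measure \<Rightarrow> (nat \<Rightarrow> 'a \<Rightarrow> nat) \<Rightarrow> nat set measure" where
  "selected_law M \<xi> = distr M subset_space (\<lambda>w. selected (\<lambda>k. \<xi> k w))"

definition environment_law ::
    "'a measure \<Rightarrow> (nat \<Rightarrow> 'a \<Rightarrow> nat) \<Rightarrow> (nat \<Rightarrow> 'a \<Rightarrow> nat) \<Rightarrow> vertex set measure" where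
  "environment_law M \<xi> \<eta> =
     distr (selected_law M \<xi> \<Otimes>\<^sub>M selected_law M \<eta>) subset_space (\<lambda>(C, R). C \<times> R)"

definition dilution_law :: "real \<Rightarrow> (vertex \<Rightarrow> bool) measure" where
  "dilution_law \<phi> = PiM UNIV (\<lambda>_. measure_pmf (bernoulli_pmf \<phi>))"

definition diluted :: "vertex set \<Rightarrow> (vertex \<Rightarrow> bool) \<Rightarrow> vertex set" where
  "diluted \<Xi> D = {v \<in> \<Xi>. D v}"


text \<open>The maps pushed forward above are measurable, and the environment law is the law of
  the random set \<open>\<C> \<times> \<R>\<close> when the two spacing sequences are independent.\<close>

lemma space_subset_space [simp]: "space subset_space = UNIV"
  by (simp add: subset_space_def space_measure_of)

lemma measurable_into_subset_space:
  fixes f :: "'a \<Rightarrow> 'b set"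
  assumes "\<And>v. {w \<in> space M. v \<in> f w} \<in> sets M"
  shows "f \<in> measurable M subset_space"
  unfolding subset_space_def
proof (rule measurable_measure_of)
  fix y :: "'b set set" assume "y \<in> range (\<lambda>v. {A. v \<in> A})"
  then obtain v where "y = {A. v \<in> A}" by auto
  then have "f -` y \<inter> space M = {w \<in> space M. v \<in> f w}" by auto
  with assms show "f -` y \<inter> space M \<in> sets M" by simp
qed auto

lemma sets_subset_space_member [measurable]: "{A. v \<in> A} \<in> sets subset_space"
  by (auto simp: subset_space_def)

lemma selected_cong:
  assumes "\<And>k. k \<ge> 1 \<Longrightarrow> s k = t k"
  shows "selected s = selected t"
proof -
  have "(\<Sum>k=1..m. s k) = (\<Sum>k=1..m. t k)" for m
    by (rule sum.cong) (use assms in auto)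
  then show ?thesis by (simp add: selected_def)
qed

lemma measurable_selected:
  "selected \<in> measurable (PiM {1..} (\<lambda>_. count_space UNIV)) subset_space"
proof (rule measurable_into_subset_space)
  fix v :: nat
  let ?N = "PiM {1..} (\<lambda>_. count_space UNIV) :: (nat \<Rightarrow> nat) measure"
  have sum_meas: "(\<lambda>s. \<Sum>k=1..m. s k) \<in> measurable ?N (count_space UNIV)" for m
  proof (induction m)
    case (Suc m)
    have "(\<lambda>s. s (Suc m)) \<in> measurable ?N (count_space UNIV)"
      by (rule measurable_component_singleton) auto
    with Suc show ?case
      by simp
  qed simp
  have "{s \<in> space ?N. v \<in> selected s} =
      {s \<in> space ?N. v = 0} \<union> (\<Union>m\<in>{1..}. (\<lambda>s. \<Sum>k=1..m. s k) -` {v} \<inter> space ?N)"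
    by (auto simp: selected_def)
  also have "\<dots> \<in> sets ?N"
    by (intro sets.Un sets.countable_UN' measurable_sets[OF sum_meas]) auto
  finally show "{s \<in> space ?N. v \<in> selected s} \<in> sets ?N" .
qed

lemma measurable_Times_subset_space:
  "(\<lambda>(C, R). C \<times> R) \<in> measurable (subset_space \<Otimes>\<^sub>M subset_space) subset_space"
proof (rule measurable_into_subset_space)
  fix v :: "'a \<times> 'b"
  have "{w \<in> space (subset_space \<Otimes>\<^sub>M subset_space). v \<in> (case w of (C, R) \<Rightarrow> C \<times> R)} =
      {C. fst v \<in> C} \<times> {R. snd v \<in> R}"
    by (auto simp: space_pair_measure mem_Times_iff)
  also have "\<dots> \<in> sets (subset_space \<Otimes>\<^sub>M subset_space)"
    by (intro pair_measureI sets_subset_space_member)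
  finally show "{w \<in> space (subset_space \<Otimes>\<^sub>M subset_space).
      v \<in> (case w of (C, R) \<Rightarrow> C \<times> R)} \<in> sets (subset_space \<Otimes>\<^sub>M subset_space)" .
qed

lemma environment_law_eq:
  assumes "prob_space M" and "indep_spacings M \<xi> \<eta>"
  shows "environment_law M \<xi> \<eta> =
    distr M subset_space (\<lambda>w. selected (\<lambda>k. \<xi> k w) \<times> selected (\<lambda>k. \<eta> k w))"
proof -
  interpret prob_space M by fact
  have restr: "(\<lambda>w. selected (\<lambda>k\<in>{1..}. \<zeta> k w)) = (\<lambda>w. selected (\<lambda>k. \<zeta> k w))"
    for \<zeta> :: "nat \<Rightarrow> 'a \<Rightarrow> nat"
    by (rule ext, rule selected_cong) simp
  have "indep_var subset_space (selected \<circ> (\<lambda>w. \<lambda>k\<in>{1..}. \<xi> k w))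
      subset_space (selected \<circ> (\<lambda>w. \<lambda>k\<in>{1..}. \<eta> k w))"
    using assms(2) unfolding indep_spacings_def
    by (rule indep_var_compose) (rule measurable_selected)+
  then have ind: "indep_var subset_space (\<lambda>w. selected (\<lambda>k. \<xi> k w))
      subset_space (\<lambda>w. selected (\<lambda>k. \<eta> k w))"
    by (simp only: comp_def restr)
  then have rv: "random_variable subset_space (\<lambda>w. selected (\<lambda>k. \<xi> k w))"
      "random_variable subset_space (\<lambda>w. selected (\<lambda>k. \<eta> k w))"
    by (auto dest: indep_var_rv1 indep_var_rv2)
  have "selected_law M \<xi> \<Otimes>\<^sub>M selected_law M \<eta> =
      distr M (subset_space \<Otimes>\<^sub>M subset_space)
        (\<lambda>w. (selected (\<lambda>k. \<xi> k w), selected (\<lambda>k. \<eta> k w)))"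
    using ind unfolding indep_var_distribution_eq selected_law_def by simp
  then show ?thesis
    unfolding environment_law_def
    using rv by (simp add: distr_distr measurable_Times_subset_space comp_def)
qed

end

theory Submission
  imports Defs
begin

text \<open>Fix the environment \<open>\<Xi>\<close> and write \<open>p = p_crit + \<epsilon>'\<close>, \<open>q = p_crit\<close>. If the dilution is averaged
  out, a site of \<open>\<Xi>\<close> is open with probability \<open>\<phi> p + (1 - \<phi>) q = p_crit + \<phi> \<epsilon>'\<close>, and the sites
  remain independent. So the average over \<open>D\<close> of the percolation probability in \<open>diluted \<Xi> D\<close> is
  the percolation probability in \<open>\<Xi>\<close> with parameters \<open>p_crit + \<phi> \<epsilon>'\<close> and \<open>p_crit\<close>
  (\<open>percolation_measure_average_dilution\<close>), and this is positive for almost every \<open>\<Xi>\<close> by the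
  hypothesis at \<open>\<epsilon> = \<phi> \<epsilon>'\<close>. Hence percolation in the diluted environment has positive probability
  for a set of dilutions \<open>D\<close> that is not null.
  
  To pass to almost every \<open>D\<close>, observe that this set is insensitive to changing \<open>D\<close> at finitely
  many sites (\<open>percolation_prob_pos_finite_change\<close>): percolation is an increasing event, and forcing
  finitely many sites to be open costs only a positive factor as long as all the parameters are
  positive. Kolmogorov's law (\<open>finite_change_zero_one_law\<close>) then gives the set probability 1.
  
  Positivity of the parameters means \<open>p_crit > 0\<close>. This is the classical path-counting bound: below
  \<open>1/4\<close> the expected number of open self-avoiding walks with \<open>n\<close> vertices from the origin tends
  to 0 (\<open>no_percolation_below_quarter\<close>).
  
  Finally, almost sure statements for \<open>\<Xi>\<close> and then for \<open>D\<close> combine into one for the pair, because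
  the percolation probability depends measurably on the environment; a product measure is a
  measurable function of its marginals (\<open>measurable_PiM_kernel\<close>).\<close>

section \<open>Products of probability kernels\<close>

text \<open>Measurability of a kernel need only be tested on cylinders, and on a cylinder the product
  measure is a finite product of measurable functions.\<close>

lemma measurable_PiM_kernel:
  fixes K :: "'i \<Rightarrow> 's \<Rightarrow> 'a measure"
  assumes K: "\<And>i. i \<in> I \<Longrightarrow> K i \<in> S \<rightarrow>\<^sub>M prob_algebra (N i)"
  shows "(\<lambda>s. PiM I (\<lambda>i. K i s)) \<in> S \<rightarrow>\<^sub>M prob_algebra (PiM I N)"
proof (rule measurable_prob_algebra_generated
    [OF sets_PiM Int_stable_prod_algebra prod_algebra_sets_into_space])
  fix s assume "s \<in> space S"
  then have K_s: "K i s \<in> space (prob_algebra (N i))" if "i \<in> I" for i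
    using K[OF that] by (rule measurable_space[rotated])
  then show "prob_space (PiM I (\<lambda>i. K i s))"
    by (intro prob_space_PiM) (simp add: space_prob_algebra)
  from K_s show "sets (PiM I (\<lambda>i. K i s)) = sets (PiM I N)"
    by (intro sets_PiM_cong) (simp_all add: space_prob_algebra)
next
  fix X assume "X \<in> prod_algebra I N"
  then obtain J E where X: "X = prod_emb I N J (Pi\<^sub>E J E)" and "finite J" "J \<subseteq> I"
    and E: "\<And>i. i \<in> J \<Longrightarrow> E i \<in> sets (N i)"
    by (rule prod_algebraE) blast
  have "emeasure (PiM I (\<lambda>i. K i s)) X = (\<Prod>i\<in>J. emeasure (K i s) (E i))"
    if "s \<in> space S" for s
  proof -
    have K_s: "prob_space (K i s) \<and> sets (K i s) = sets (N i)" if "i \<in> I" for i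
      using measurable_space[OF K[OF that] \<open>s \<in> space S\<close>] by (simp add: space_prob_algebra)
    then have "X = prod_emb I (\<lambda>i. K i s) J (Pi\<^sub>E J E)"
      unfolding X prod_emb_def
      by (intro arg_cong2[where f="(\<inter>)"] PiE_cong refl) (metis sets_eq_imp_space_eq)
    then show ?thesis
      using K_s E \<open>J \<subseteq> I\<close> \<open>finite J\<close> by (auto intro!: emeasure_PiM_emb)
  qed
  moreover have "(\<lambda>s. \<Prod>i\<in>J. emeasure (K i s) (E i)) \<in> borel_measurable S"
    using K E \<open>J \<subseteq> I\<close>
    by (intro borel_measurable_prod_ennreal measurable_emeasure_kernel)
       (auto intro: measurable_prob_algebraD)
  ultimately show "(\<lambda>s. emeasure (PiM I (\<lambda>i. K i s)) X) \<in> borel_measurable S"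
    by (simp cong: measurable_cong)
qed

lemma indep_vars_PiM_coordinates:
  fixes M :: "'i \<Rightarrow> 'a measure" and e :: "'j \<Rightarrow> 'i"
  assumes M: "\<And>i. prob_space (M i)" and "inj e"
  shows "prob_space.indep_vars (PiM UNIV M) (\<lambda>j. M (e j)) (\<lambda>j \<omega>. \<omega> (e j)) UNIV"
proof -
  interpret product_prob_space M UNIV
    using M by (simp add: product_prob_space_def product_prob_space_axioms_def
        product_sigma_finite_def prob_space_imp_sigma_finite)
  have "distr (PiM UNIV M) (\<Pi>\<^sub>M j\<in>UNIV. M (e j)) (\<lambda>\<omega>. \<lambda>j\<in>UNIV. \<omega> (e j)) = (\<Pi>\<^sub>M j\<in>UNIV. M (e j))"
    using M \<open>inj e\<close> by (intro distr_PiM_reindex) auto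
  then show ?thesis
    by (subst P.indep_vars_iff_distr_eq_PiM) (simp_all add: PiM_component)
qed

text \<open>Randomising every coordinate separately is the same as first drawing all the parameters
  \<open>D i\<close> independently and then drawing the product measure they prescribe. On a cylinder the
  second description gives the integral of a finite product of functions of distinct, hence
  independent, coordinates, and this factorises.\<close>

lemma PiM_bind:
  fixes P :: "'i \<Rightarrow> 'a measure" and K :: "'i \<Rightarrow> 'a \<Rightarrow> 'b measure"
  assumes prob_P: "\<And>i. prob_space (P i)" and K: "\<And>i. K i \<in> P i \<rightarrow>\<^sub>M prob_algebra (N i)"
  shows "PiM UNIV (\<lambda>i. P i \<bind> K i) = PiM UNIV P \<bind> (\<lambda>D. PiM UNIV (\<lambda>i. K i (D i)))"
proof (rule measure_eqI_PiM_infinite)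
  interpret product_prob_space P UNIV
    using prob_P by (simp add: product_prob_space_def product_prob_space_axioms_def
        product_sigma_finite_def prob_space_imp_sigma_finite)
  have P_alg: "P i \<in> space (prob_algebra (P i))" for i
    using prob_P by (simp add: space_prob_algebra)
  have PiM_alg: "PiM UNIV P \<in> space (prob_algebra (PiM UNIV P))"
    by (simp add: space_prob_algebra P.prob_space_axioms)
  have comp: "(\<lambda>D. K i (D i)) \<in> PiM UNIV P \<rightarrow>\<^sub>M prob_algebra (N i)" for i
    using K by (rule measurable_compose[rotated]) simp
  then have kernel: "(\<lambda>D. PiM UNIV (\<lambda>i. K i (D i))) \<in> PiM UNIV P \<rightarrow>\<^sub>M prob_algebra (PiM UNIV N)"
    by (rule measurable_PiM_kernel)
  have prob: "prob_space (P i \<bind> K i)" and sets: "sets (P i \<bind> K i) = sets (N i)" for i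
    using prob_space_bind'[OF P_alg K] sets_bind'[OF P_alg K] by auto
  then show sets_prod: "sets (PiM UNIV (\<lambda>i. P i \<bind> K i)) = sets (PiM UNIV N)"
    by (intro sets_PiM_cong) auto
  show "sets (PiM UNIV P \<bind> (\<lambda>D. PiM UNIV (\<lambda>i. K i (D i)))) = sets (PiM UNIV N)"
    by (rule sets_bind'[OF PiM_alg kernel])
  show "finite_measure (PiM UNIV (\<lambda>i. P i \<bind> K i))"
    using prob by (intro prob_space.finite_measure prob_space_PiM)
  fix A J assume "finite (J :: 'i set)" and A: "\<And>i. i \<in> J \<Longrightarrow> A i \<in> sets (N i)"
  let ?C = "prod_emb UNIV N J (Pi\<^sub>E J A)"
  have C: "?C \<in> sets (PiM UNIV N)"
    using A \<open>finite J\<close> by (intro sets_PiM_I) auto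
  have emb: "?C = prod_emb UNIV L J (Pi\<^sub>E J A)" if "\<And>i. sets (L i) = sets (N i)" for L
    using sets_eq_imp_space_eq[OF that] by (simp add: prod_emb_def)
  have cyl: "emeasure (PiM UNIV L) ?C = (\<Prod>i\<in>J. emeasure (L i) (A i))"
    if "\<And>i. prob_space (L i)" "\<And>i. sets (L i) = sets (N i)" for L
    unfolding emb[of L, OF that(2)] using that A \<open>finite J\<close>
    by (intro Infinite_Product_Measure.emeasure_PiM_emb) auto
  have indep: "P.indep_vars (\<lambda>_. borel) (\<lambda>i D. emeasure (K i (D i)) (A i)) J"
  proof (rule P.indep_vars_compose2[where X = "\<lambda>i D. D i"
        and Y = "\<lambda>i d. emeasure (K i d) (A i)" and M' = P])
    show "P.indep_vars P (\<lambda>i D. D i) J"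
      using P.indep_vars_subset[OF indep_vars_PiM_coordinates[OF prob_P, of id]] by simp
    show "(\<lambda>d. emeasure (K i d) (A i)) \<in> borel_measurable (P i)" if "i \<in> J" for i
      using measurable_prob_algebraD[OF K] A[OF that] by (rule measurable_emeasure_kernel)
  qed
  have "emeasure (PiM UNIV P \<bind> (\<lambda>D. PiM UNIV (\<lambda>i. K i (D i)))) ?C
      = (\<integral>\<^sup>+D. emeasure (PiM UNIV (\<lambda>i. K i (D i))) ?C \<partial>PiM UNIV P)"
    by (rule emeasure_bind_prob_algebra[OF PiM_alg kernel C])
  also have "\<dots> = (\<integral>\<^sup>+D. (\<Prod>i\<in>J. emeasure (K i (D i)) (A i)) \<partial>PiM UNIV P)"
    using measurable_space[OF comp]
    by (intro nn_integral_cong cyl) (auto simp: space_prob_algebra)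
  also have "\<dots> = (\<Prod>i\<in>J. \<integral>\<^sup>+D. emeasure (K i (D i)) (A i) \<partial>PiM UNIV P)"
    by (rule P.indep_vars_nn_integral[OF \<open>finite J\<close> indep]) simp
  also have "\<dots> = (\<Prod>i\<in>J. emeasure (P i \<bind> K i) (A i))"
  proof (rule prod.cong[OF refl])
    fix i assume "i \<in> J"
    have "(\<integral>\<^sup>+D. emeasure (K i (D i)) (A i) \<partial>PiM UNIV P)
        = (\<integral>\<^sup>+d. emeasure (K i d) (A i) \<partial>distr (PiM UNIV P) (P i) (\<lambda>D. D i))"
      using measurable_emeasure_kernel[OF measurable_prob_algebraD[OF K] A[OF \<open>i \<in> J\<close>]]
      by (simp add: nn_integral_distr)
    also have "\<dots> = emeasure (P i \<bind> K i) (A i)"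
      using emeasure_bind_prob_algebra[OF P_alg K A[OF \<open>i \<in> J\<close>]] by (simp add: PiM_component)
    finally show "(\<integral>\<^sup>+D. emeasure (K i (D i)) (A i) \<partial>PiM UNIV P) = emeasure (P i \<bind> K i) (A i)" .
  qed
  also have "\<dots> = emeasure (PiM UNIV (\<lambda>i. P i \<bind> K i)) ?C"
    by (rule cyl[OF prob sets, symmetric])
  finally show "emeasure (PiM UNIV (\<lambda>i. P i \<bind> K i)) ?C
      = emeasure (PiM UNIV P \<bind> (\<lambda>D. PiM UNIV (\<lambda>i. K i (D i)))) ?C" ..
qed

section \<open>A zero-one law\<close>

text \<open>Overwriting the first \<open>n\<close> coordinates by constants does not affect membership in \<open>T\<close>, so \<open>T\<close>
  is determined by the coordinates from \<open>n\<close> on, for every \<open>n\<close>: it is a tail event, and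
  Kolmogorov's law applies.\<close>

lemma finite_change_zero_one_law:
  fixes M :: "'i \<Rightarrow> 'a measure" and e :: "nat \<Rightarrow> 'i"
  assumes M: "\<And>i. prob_space (M i)" and e: "bij e"
    and T: "T \<in> sets (PiM UNIV M)"
    and inv: "\<And>x y. x \<in> T \<Longrightarrow> y \<in> space (PiM UNIV M) \<Longrightarrow> finite {i. x i \<noteq> y i} \<Longrightarrow> y \<in> T"
  shows "measure (PiM UNIV M) T = 0 \<or> measure (PiM UNIV M) T = 1"
proof -
  let ?\<Omega> = "space (PiM UNIV M)"
  interpret prob_space "PiM UNIV M"
    using M by (rule prob_space_PiM)
  define A where "A n = {(\<lambda>\<omega>. \<omega> (e n)) -` B \<inter> ?\<Omega> | B. B \<in> sets (M (e n))}" for n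
  have "indep_vars (\<lambda>n. M (e n)) (\<lambda>n \<omega>. \<omega> (e n)) UNIV"
    using M e by (intro indep_vars_PiM_coordinates) (auto simp: bij_def)
  then have indep: "indep_sets A UNIV"
    unfolding indep_vars_def2 A_def by simp
  have "sigma_algebra ?\<Omega> (A n)" for n
    proof -
    have "A n = sets (vimage_algebra ?\<Omega> (\<lambda>\<omega>. \<omega> (e n)) (M (e n)))"
      by (subst sets_vimage_algebra2) (auto simp: A_def space_PiM)
    then show ?thesis
      by (metis sets.sigma_algebra_axioms space_vimage_algebra)
  qed
  moreover have "T \<in> tail_events A"
    unfolding tail_events_def
  proof
    fix n
    \<comment> \<open>Erasing the information at the first \<open>n\<close> indices keeps a point inside or outside \<open>T\<close>.\<close>
    define c where "c i = (SOME a. a \<in> space (M i))" for i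
    have c: "c i \<in> space (M i)" for i
      using prob_space.not_empty[OF M] by (simp add: c_def some_in_eq)
    define forget where "forget \<omega> = (\<lambda>i. if i \<in> e ` {..<n} then c i else \<omega> i)" for \<omega>
    have forget_space: "forget \<omega> \<in> ?\<Omega>" if "\<omega> \<in> ?\<Omega>" for \<omega>
      using that c by (auto simp: forget_def space_PiM)
    have "finite {i. \<omega> i \<noteq> forget \<omega> i}" "finite {i. forget \<omega> i \<noteq> \<omega> i}" for \<omega>
      by (rule finite_subset[of _ "e ` {..<n}"]; auto simp: forget_def)+
    then have "\<omega> \<in> T \<longleftrightarrow> forget \<omega> \<in> T" if "\<omega> \<in> ?\<Omega>" for \<omega>
      using inv that forget_space by metis
    then have T_eq: "T = forget -` T \<inter> ?\<Omega>"
      using sets.sets_into_space[OF T] by blast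
    let ?F = "sigma ?\<Omega> (\<Union> (A ` {n..}))"
    have A_space: "\<Union> (A ` {n..}) \<subseteq> Pow ?\<Omega>"
      by (auto simp: A_def)
    have "forget \<in> ?F \<rightarrow>\<^sub>M PiM UNIV M"
    proof (rule measurable_PiM_single)
      show "forget \<in> space ?F \<rightarrow> (\<Pi>\<^sub>E i\<in>UNIV. space (M i))"
        using forget_space A_space by (auto simp: space_PiM)
      fix B i assume B: "B \<in> sets (M i)"
      obtain m where m: "i = e m"
        using e by (meson bij_pointE)
      show "{\<omega> \<in> space ?F. forget \<omega> i \<in> B} \<in> sets ?F"
      proof (cases "m < n")
        case True
        then have "{\<omega> \<in> space ?F. forget \<omega> i \<in> B} = (if c i \<in> B then space ?F else {})"
          by (auto simp: forget_def m)
        then show ?thesis by (simp del: space_measure_of_conv)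
      next
        case False
        then have "{\<omega> \<in> space ?F. forget \<omega> i \<in> B} = (\<lambda>\<omega>. \<omega> (e m)) -` B \<inter> ?\<Omega>"
          using e A_space by (auto simp: forget_def m bij_def inj_eq)
        also have "\<dots> \<in> \<Union> (A ` {n..})"
          using False B m by (auto simp: A_def intro!: bexI[of _ m])
        finally show ?thesis
          using A_space by auto
      qed
    qed
    then have "forget -` T \<inter> space ?F \<in> sets ?F"
      using T by (rule measurable_sets)
    then show "T \<in> sigma_sets ?\<Omega> (\<Union> (A ` {n..}))"
      using A_space T_eq by simp
  qed
  ultimately show ?thesis
    using indep by (intro kolmogorov_0_1_law)
qed

section \<open>Bernoulli fields and increasing events\<close>

definition bernoulli_field :: "('i \<Rightarrow> real) \<Rightarrow> ('i \<Rightarrow> bool) measure" where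
  "bernoulli_field r = PiM UNIV (\<lambda>i. measure_pmf (bernoulli_pmf (r i)))"

lemma percolation_measure_eq_bernoulli_field:
  "percolation_measure A p q = bernoulli_field (\<lambda>v. if v \<in> A then p else q)"
  by (simp add: percolation_measure_def bernoulli_field_def)

lemma dilution_law_eq_bernoulli_field: "dilution_law \<phi> = bernoulli_field (\<lambda>_. \<phi>)"
  by (simp add: dilution_law_def bernoulli_field_def)

lemma sets_bernoulli_field [measurable_cong]:
  "sets (bernoulli_field r) = sets (PiM UNIV (\<lambda>_. count_space UNIV))"
  unfolding bernoulli_field_def by (intro sets_PiM_cong) auto

lemma space_bernoulli_field [simp]: "space (bernoulli_field r) = UNIV"
  by (simp add: bernoulli_field_def space_PiM)

lemma prob_space_bernoulli_field: "prob_space (bernoulli_field r)"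
  unfolding bernoulli_field_def
  by (intro prob_space_PiM measure_pmf.prob_space_axioms)

text \<open>Only the outer integral depends on the parameter at \<open>v\<close>; the inner measure sees the other sites.\<close>

lemma bernoulli_field_split_site:
  assumes E: "E \<in> sets (PiM UNIV (\<lambda>_. count_space UNIV))"
  shows "emeasure (bernoulli_field r) E =
    (\<integral>\<^sup>+b. emeasure (PiM (UNIV - {v}) (\<lambda>i. measure_pmf (bernoulli_pmf (r i))))
        {x \<in> space (PiM (UNIV - {v}) (\<lambda>_. count_space UNIV)). x(v := b) \<in> E}
      \<partial>bernoulli_pmf (r v))"
proof -
  let ?B = "\<lambda>i. measure_pmf (bernoulli_pmf (r i))"
  let ?R = "PiM (UNIV - {v}) ?B"
  interpret R: prob_space ?R
    by (intro prob_space_PiM measure_pmf.prob_space_axioms)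
  have ins: "insert v (UNIV - {v}) = UNIV" by auto
  have space_R: "space ?R = space (PiM (UNIV - {v}) (\<lambda>_. count_space UNIV))"
    by (simp add: space_PiM)
  have E': "E \<in> sets (PiM UNIV ?B)"
    using E sets_bernoulli_field[of r] by (simp add: bernoulli_field_def)
  have glue: "(\<lambda>(b, x). x(v := b)) \<in> ?B v \<Otimes>\<^sub>M ?R \<rightarrow>\<^sub>M PiM UNIV ?B"
    unfolding split_beta
    by (rule measurable_fun_upd[where J = "UNIV - {v}"]) auto
  have "PiM UNIV ?B = distr (?B v \<Otimes>\<^sub>M ?R) (PiM UNIV ?B) (\<lambda>(b, x). x(v := b))"
    using distr_pair_PiM_eq_PiM[of "UNIV - {v}" ?B v, OF measure_pmf.prob_space_axioms
        measure_pmf.prob_space_axioms]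
    by (simp add: ins)
  then have "emeasure (bernoulli_field r) E
      = emeasure (?B v \<Otimes>\<^sub>M ?R) ((\<lambda>(b, x). x(v := b)) -` E \<inter> space (?B v \<Otimes>\<^sub>M ?R))"
    unfolding bernoulli_field_def using emeasure_distr[OF glue E'] by simp
  also have "\<dots> = (\<integral>\<^sup>+b. emeasure ?R (Pair b -` ((\<lambda>(b, x). x(v := b)) -` E \<inter> space (?B v \<Otimes>\<^sub>M ?R)))
      \<partial>?B v)"
    by (rule R.emeasure_pair_measure_alt[OF measurable_sets[OF glue E']])
  also have "\<dots> = (\<integral>\<^sup>+b. emeasure ?R
        {x \<in> space (PiM (UNIV - {v}) (\<lambda>_. count_space UNIV)). x(v := b) \<in> E} \<partial>?B v)"
    by (intro nn_integral_cong arg_cong2[where f = emeasure] refl)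
       (auto simp: space_pair_measure space_R)
  finally show ?thesis .
qed

definition increasing_event :: "('i \<Rightarrow> bool) set \<Rightarrow> bool" where
  "increasing_event E \<longleftrightarrow> (\<forall>\<omega> \<omega>'. \<omega> \<in> E \<longrightarrow> (\<forall>i. \<omega> i \<longrightarrow> \<omega>' i) \<longrightarrow> \<omega>' \<in> E)"

text \<open>An increasing event is at least as likely when \<open>v\<close> is declared open as when \<open>v\<close> is declared
  closed. As \<open>v\<close> is open with positive probability, the event is null exactly when its section
  with \<open>v\<close> open is null. The point is that the right-hand side does not involve \<open>r v\<close>. Parameters
  equal to 1 are covered, whereas the two measures for different values of \<open>r v\<close> need then not be
  equivalent; this is why monotonicity is used.\<close>

lemma increasing_event_positive_iff_site:
  assumes E: "E \<in> sets (PiM UNIV (\<lambda>_. count_space UNIV))" and inc: "increasing_event E"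
    and "0 < r v" "r v \<le> 1"
  shows "emeasure (bernoulli_field r) E \<noteq> 0 \<longleftrightarrow>
    emeasure (PiM (UNIV - {v}) (\<lambda>i. measure_pmf (bernoulli_pmf (r i))))
        {x \<in> space (PiM (UNIV - {v}) (\<lambda>_. count_space UNIV)). x(v := True) \<in> E} \<noteq> 0"
    (is "_ \<longleftrightarrow> emeasure ?R (?S True) \<noteq> 0")
proof -
  have sets_R: "sets ?R = sets (PiM (UNIV - {v}) (\<lambda>_. count_space UNIV))"
    by (intro sets_PiM_cong) auto
  have "(\<lambda>x. x(v := b)) \<in> PiM (UNIV - {v}) (\<lambda>_. count_space UNIV) \<rightarrow>\<^sub>M PiM UNIV (\<lambda>_. count_space UNIV)"
    for b :: bool
    by (rule measurable_fun_upd[where J = "UNIV - {v}"]) auto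
  then have "(\<lambda>x. x(v := b)) -` E \<inter> space (PiM (UNIV - {v}) (\<lambda>_. count_space UNIV))
      \<in> sets (PiM (UNIV - {v}) (\<lambda>_. count_space UNIV))" for b
    using E by (rule measurable_sets)
  moreover have "?S b = (\<lambda>x. x(v := b)) -` E \<inter> space (PiM (UNIV - {v}) (\<lambda>_. count_space UNIV))" for b
    by (auto simp del: fun_upd_apply)
  ultimately have S: "?S b \<in> sets ?R" for b
    unfolding sets_R by simp
  have "?S False \<subseteq> ?S True"
  proof safe
    fix x assume "x(v := False) \<in> E"
    with inc show "x(v := True) \<in> E"
      unfolding increasing_event_def by (metis (no_types, lifting) fun_upd_apply)
  qed
  then have le: "emeasure ?R (?S False) \<le> emeasure ?R (?S True)"
    using S by (rule emeasure_mono)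
  have split: "emeasure (bernoulli_field r) E
      = ennreal (r v) * emeasure ?R (?S True) + ennreal (1 - r v) * emeasure ?R (?S False)"
    using assms by (subst bernoulli_field_split_site[OF E, of r v]) (simp add: mult.commute)
  have "ennreal (r v) * a + ennreal (1 - r v) * b \<noteq> 0 \<longleftrightarrow> a \<noteq> 0" if "b \<le> a" for a b
    using \<open>0 < r v\<close> that by (auto simp: ennreal_eq_0_iff)
  from this[OF le] show ?thesis
    unfolding split .
qed

lemma increasing_event_positive_finite_change:
  assumes E: "E \<in> sets (PiM UNIV (\<lambda>_. count_space UNIV))" and inc: "increasing_event E"
    and r: "\<And>i. 0 < r i \<and> r i \<le> 1" and s: "\<And>i. 0 < s i \<and> s i \<le> 1"
    and fin: "finite {i. r i \<noteq> s i}"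
    and pos: "emeasure (bernoulli_field r) E \<noteq> 0"
  shows "emeasure (bernoulli_field s) E \<noteq> 0"
proof -
  \<comment> \<open>The sites where the parameters differ are switched from \<open>r\<close> to \<open>s\<close> one at a time.\<close>
  have "emeasure (bernoulli_field (\<lambda>i. if i \<in> F then s i else r i)) E \<noteq> 0" if "finite F" for F
    using that
  proof (induction F)
    case empty
    then show ?case using pos by simp
  next
    case (insert v F)
    let ?old = "\<lambda>i. if i \<in> F then s i else r i"
    let ?new = "\<lambda>i. if i \<in> insert v F then s i else r i"
    have "PiM (UNIV - {v}) (\<lambda>i. measure_pmf (bernoulli_pmf (?old i)))
        = PiM (UNIV - {v}) (\<lambda>i. measure_pmf (bernoulli_pmf (?new i)))"
      by (rule PiM_cong) auto
    then show ?case
      using insert.IH increasing_event_positive_iff_site[OF E inc, of ?old v]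
        increasing_event_positive_iff_site[OF E inc, of ?new v] r s by simp
  qed
  from this[OF fin]
  have "emeasure (bernoulli_field (\<lambda>i. if i \<in> {i. r i \<noteq> s i} then s i else r i)) E \<noteq> 0" .
  also have "(\<lambda>i. if i \<in> {i. r i \<noteq> s i} then s i else r i) = s"
    by auto
  finally show ?thesis .
qed

section \<open>Measurability in the environment and averaging over the dilution\<close>

lemma bernoulli_mixture:
  assumes "\<phi> \<in> {0..1}" "p \<in> {0..1}" "q \<in> {0..1}"
  shows "bernoulli_pmf \<phi> \<bind> (\<lambda>d. bernoulli_pmf (if d then p else q)) = bernoulli_pmf (q + \<phi> * (p - q))"
proof (rule pmf_eqI)
  have "q + \<phi> * (p - q) = (1 - \<phi>) * q + \<phi> * p" by (simp add: algebra_simps)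
  moreover have "0 \<le> (1 - \<phi>) * q + \<phi> * p" using assms by simp
  moreover have "(1 - \<phi>) * q + \<phi> * p \<le> 1"
    using assms convex_bound_le[of q 1 p "1 - \<phi>" \<phi>] by simp
  ultimately show "pmf (bernoulli_pmf \<phi> \<bind> (\<lambda>d. bernoulli_pmf (if d then p else q))) b =
      pmf (bernoulli_pmf (q + \<phi> * (p - q))) b" for b
    using assms by (cases b) (simp_all add: pmf_bind algebra_simps)
qed

lemma measure_pmf_in_prob_algebra: "measure_pmf P \<in> space (prob_algebra (count_space UNIV))"
  by (simp add: space_prob_algebra measure_pmf.prob_space_axioms)

lemma measurable_percolation_measure:
  "(\<lambda>A. percolation_measure A p q) \<in> subset_space \<rightarrow>\<^sub>M prob_algebra (PiM UNIV (\<lambda>_. count_space UNIV))"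
  unfolding percolation_measure_def
proof (rule measurable_PiM_kernel)
  fix v :: vertex
  have "(\<lambda>A. v \<in> A) \<in> subset_space \<rightarrow>\<^sub>M count_space UNIV"
    by (rule pred_intros_logic | simp add: pred_def)+
  moreover have "(\<lambda>b. measure_pmf (bernoulli_pmf (if b then p else q)))
      \<in> count_space UNIV \<rightarrow>\<^sub>M prob_algebra (count_space UNIV)"
    by (simp add: measure_pmf_in_prob_algebra)
  ultimately show "(\<lambda>A. measure_pmf (bernoulli_pmf (if v \<in> A then p else q)))
      \<in> subset_space \<rightarrow>\<^sub>M prob_algebra (count_space UNIV)"
    by (rule measurable_compose)
qed

text \<open>A site of \<open>\<Xi>\<close> keeps the parameter \<open>p\<close> with probability \<open>\<phi>\<close> and drops to \<open>q\<close> otherwise,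
  independently of the other sites; averaged over the dilution it is therefore open with
  probability \<open>q + \<phi> (p - q)\<close>.\<close>

lemma percolation_measure_average_dilution:
  assumes "\<phi> \<in> {0..1}" "p \<in> {0..1}" "q \<in> {0..1}"
    and E: "E \<in> sets (PiM UNIV (\<lambda>_. count_space UNIV))"
  shows "emeasure (percolation_measure \<Xi> (q + \<phi> * (p - q)) q) E =
    (\<integral>\<^sup>+D. emeasure (percolation_measure (diluted \<Xi> D) p q) E \<partial>dilution_law \<phi>)"
proof -
  let ?N = "count_space UNIV :: bool measure"
  let ?K = "\<lambda>v d. measure_pmf (bernoulli_pmf (if v \<in> \<Xi> \<and> d then p else q))"
  have K: "?K v \<in> measure_pmf (bernoulli_pmf \<phi>) \<rightarrow>\<^sub>M prob_algebra ?N" for v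
    by (simp add: measure_pmf_in_prob_algebra)
  have site: "measure_pmf (bernoulli_pmf (if v \<in> \<Xi> then q + \<phi> * (p - q) else q))
      = measure_pmf (bernoulli_pmf \<phi>) \<bind> ?K v" for v
    using bernoulli_mixture[OF assms(1-3)]
    by (cases "v \<in> \<Xi>") (simp_all flip: measure_pmf_bind)
  have kernel: "(\<lambda>D. PiM UNIV (\<lambda>v. ?K v (D v))) \<in> dilution_law \<phi> \<rightarrow>\<^sub>M prob_algebra (PiM UNIV (\<lambda>_. ?N))"
    unfolding dilution_law_def
    by (rule measurable_PiM_kernel, rule measurable_compose[OF _ K]) simp
  have "percolation_measure \<Xi> (q + \<phi> * (p - q)) q = dilution_law \<phi> \<bind> (\<lambda>D. PiM UNIV (\<lambda>v. ?K v (D v)))"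
    unfolding percolation_measure_def site dilution_law_def
    by (rule PiM_bind[OF measure_pmf.prob_space_axioms K])
  moreover have "dilution_law \<phi> \<in> space (prob_algebra (dilution_law \<phi>))"
    by (simp add: space_prob_algebra dilution_law_eq_bernoulli_field prob_space_bernoulli_field)
  ultimately show ?thesis
    using emeasure_bind_prob_algebra[OF _ kernel E]
    by (simp add: percolation_measure_def diluted_def)
qed

section \<open>The event of percolation\<close>

lemma sets_all_open:
  assumes "finite S"
  shows "{\<omega>. \<forall>i\<in>S. \<omega> i} \<in> sets (PiM UNIV (\<lambda>_. count_space UNIV))"
proof -
  let ?N = "PiM UNIV (\<lambda>_. count_space UNIV) :: ('a \<Rightarrow> bool) measure"
  have "{\<omega> \<in> space ?N. \<forall>i\<in>S. \<omega> i} \<in> sets ?N"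
  proof (rule sets.sets_Collect_finite_All[OF _ assms])
    fix i
    have "(\<lambda>\<omega>. \<omega> i) -` {True} \<inter> space ?N \<in> sets ?N"
      by (rule measurable_sets[OF measurable_component_singleton]) auto
    then show "{\<omega> \<in> space ?N. \<omega> i} \<in> sets ?N"
      by (simp add: vimage_def Int_def conj_commute)
  qed
  then show ?thesis by (simp add: space_PiM)
qed

lemma measure_bernoulli_field_all_open:
  assumes "finite S" "p \<in> {0..1}"
  shows "measure (bernoulli_field (\<lambda>_. p)) {\<omega>. \<forall>i\<in>S. \<omega> i} = p ^ card S"
proof -
  have "emeasure (bernoulli_field (\<lambda>_. p))
      (prod_emb UNIV (\<lambda>_. measure_pmf (bernoulli_pmf p)) S (Pi\<^sub>E S (\<lambda>_. {True})))
      = (\<Prod>i\<in>S. emeasure (measure_pmf (bernoulli_pmf p)) {True})"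
    unfolding bernoulli_field_def
    by (rule emeasure_PiM_emb) (use assms measure_pmf.prob_space_axioms in auto)
  also have "prod_emb UNIV (\<lambda>_. measure_pmf (bernoulli_pmf p)) S (Pi\<^sub>E S (\<lambda>_. {True}))
      = {\<omega>. \<forall>i\<in>S. \<omega> i}"
    by (auto simp: prod_emb_def PiE_iff restrict_def fun_eq_iff)
  finally show ?thesis
    using assms by (simp add: measure_def emeasure_pmf_single ennreal_power)
qed

lemma connected_in_mono:
  assumes "connected_in \<omega> u v" "\<And>w. \<omega> w \<Longrightarrow> \<omega>' w"
  shows "connected_in \<omega>' u v"
  using assms unfolding connected_in_def by blast

lemma increasing_origin_to_infinity: "increasing_event origin_to_infinity"
  unfolding increasing_event_def origin_to_infinity_def
  by (blast intro: connected_in_mono)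

text \<open>This form exhibits the event as a countable combination of connection events, and it provides
  arbitrarily long open paths from the origin.\<close>

lemma origin_to_infinity_eq:
  "origin_to_infinity = {\<omega>. \<forall>n. \<exists>v. n \<le> fst v + snd v \<and> connected_in \<omega> (0, 0) v}"
proof (intro set_eqI iffI)
  fix \<omega> assume "\<omega> \<in> origin_to_infinity"
  then obtain x :: "nat \<Rightarrow> vertex" where unb: "\<not> bounded (range x)"
    and x: "\<And>n. connected_in \<omega> (0, 0) (x n)"
    unfolding origin_to_infinity_def by blast
  have "\<exists>k. n \<le> fst (x k) + snd (x k)" for n
  proof (rule ccontr)
    assume "\<nexists>k. n \<le> fst (x k) + snd (x k)"
    then have "fst (x k) + snd (x k) < n" for k
      by (simp add: not_le)
    then have "x k \<in> {..n} \<times> {..n}" for k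
      by (simp add: mem_Times_iff) (metis add_leE less_imp_le)
    then have "finite (range x)"
      by (intro finite_subset[of "range x" "{..n} \<times> {..n}"] image_subsetI) auto
    then have "finite ((\<lambda>(a, b). (real a, real b)) ` range x)"
      by (rule finite_imageI)
    with unb show False
      by (metis (no_types) finite_imp_bounded image_image)
  qed
  with x show "\<omega> \<in> {\<omega>. \<forall>n. \<exists>v. n \<le> fst v + snd v \<and> connected_in \<omega> (0, 0) v}"
    by blast
next
  fix \<omega> assume "\<omega> \<in> {\<omega>. \<forall>n. \<exists>v. n \<le> fst v + snd v \<and> connected_in \<omega> (0, 0) v}"
  then have "\<exists>v. n \<le> fst v + snd v \<and> connected_in \<omega> (0, 0) v" for n
    by simp
  then obtain x :: "nat \<Rightarrow> vertex" where far: "\<And>n. n \<le> fst (x n) + snd (x n)"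
    and x: "\<And>n. connected_in \<omega> (0, 0) (x n)"
    by metis
  have "\<not> bounded (range x)"
  proof
    assume "bounded (range x)"
    \<comment> \<open>Boundedness is that of the image of \<open>range x\<close> in the real plane.\<close>
    then obtain c where "norm (case x n of (a, b) \<Rightarrow> (real a, real b)) \<le> c" for n
      unfolding bounded_iff by blast
    then have "real (fst (x n)) \<le> c" "real (snd (x n)) \<le> c" for n
      using norm_fst_le[of "real (fst (x n))" "real (snd (x n))"]
        norm_snd_le[of "real (snd (x n))" "real (fst (x n))"]
      by (fastforce simp: split_beta intro: order_trans)+
    then have bound: "real n \<le> c + c" for n
      using far[of n] by (smt (verit) of_nat_add of_nat_mono)
    obtain n where "c + c < real n" using reals_Archimedean2 by blast
    with bound[of n] show False by simp
  qed
  with x show "\<omega> \<in> origin_to_infinity"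
    unfolding origin_to_infinity_def by blast
qed

lemma sets_origin_to_infinity:
  "origin_to_infinity \<in> sets (PiM UNIV (\<lambda>_. count_space UNIV))"
proof -
  let ?N = "PiM UNIV (\<lambda>_. count_space UNIV) :: (vertex \<Rightarrow> bool) measure"
  have conn: "{\<omega>. connected_in \<omega> u v} \<in> sets ?N" for u v
  proof -
    have "{\<omega>. connected_in \<omega> u v} =
        (\<Union>vs\<in>{vs. lattice_path vs \<and> hd vs = u \<and> last vs = v}. {\<omega>. \<forall>w\<in>set vs. \<omega> w})"
      by (auto simp: connected_in_def)
    also have "\<dots> \<in> sets ?N"
      by (rule sets.countable_UN') (auto intro: sets_all_open)
    finally show ?thesis .
  qed
  have "origin_to_infinity =
      (\<Inter>n. \<Union>v\<in>{v. n \<le> fst v + snd v}. {\<omega>. connected_in \<omega> (0, 0) v})"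
    by (auto simp: origin_to_infinity_eq)
  also have "\<dots> \<in> sets ?N"
    using conn sets.top[of ?N]
    by (intro sets.countable_INT'' sets.countable_UN') (auto simp: space_PiM)
  finally show ?thesis .
qed

section \<open>Positivity of the critical threshold\<close>

definition walks :: "nat \<Rightarrow> vertex \<Rightarrow> vertex list set" where
  "walks n u = {vs. length vs = Suc n \<and> hd vs = u \<and> successively adjacent vs}"

lemma neighbours_le_4: "finite {v. adjacent u v} \<and> card {v. adjacent u v} \<le> 4"
proof -
  obtain a b where u: "u = (a, b)" by fastforce
  have "{v. adjacent u v} \<subseteq> set [(a + 1, b), (a - 1, b), (a, b + 1), (a, b - 1)]"
    by (auto simp: adjacent_def u)
  note sub = this
  have "card {v. adjacent u v} \<le> card (set [(a + 1, b), (a - 1, b), (a, b + 1), (a, b - 1)])"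
    by (rule card_mono[OF finite_set sub])
  also have "\<dots> \<le> 4"
    using card_length[of "[(a + 1, b), (a - 1, b), (a, b + 1), (a, b - 1)]"] by simp
  finally show ?thesis
    using finite_subset[OF sub finite_set] by simp
qed

lemma walks_le: "finite (walks n u) \<and> card (walks n u) \<le> 4 ^ n"
proof (induction n arbitrary: u)
  case 0
  have "walks 0 u = {[u]}"
    by (auto simp: walks_def length_Suc_conv)
  then show ?case by simp
next
  case (Suc n)
  have "vs \<in> walks (Suc n) u \<longleftrightarrow> (\<exists>v\<in>{v. adjacent u v}. vs \<in> (#) u ` walks n v)" for vs
  proof (cases vs)
    case (Cons w ws)
    have "vs \<in> (#) u ` walks n v \<longleftrightarrow> w = u \<and> ws \<in> walks n v" for v
      by (auto simp: Cons)
    then show ?thesis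
      by (auto simp: Cons walks_def successively_Cons)
  qed (auto simp: walks_def)
  then have "walks (Suc n) u = (\<Union>v\<in>{v. adjacent u v}. (#) u ` walks n v)"
    by blast
  then have "card (walks (Suc n) u) = card (\<Union>v\<in>{v. adjacent u v}. (#) u ` walks n v)"
    and "finite (walks (Suc n) u)"
    using neighbours_le_4[of u] Suc.IH by auto
  note walks_eq = this
  have "card (\<Union>v\<in>{v. adjacent u v}. (#) u ` walks n v)
      \<le> (\<Sum>v\<in>{v. adjacent u v}. card ((#) u ` walks n v))"
    using neighbours_le_4 by (intro card_UN_le) blast
  also have "\<dots> \<le> card {v. adjacent u v} * 4 ^ n"
    using sum_bounded_above[of "{v. adjacent u v}" "\<lambda>v. card ((#) u ` walks n v)" "4 ^ n"] Suc.IH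
    by (simp add: card_image)
  also have "\<dots> \<le> 4 * 4 ^ n"
    using neighbours_le_4[of u] by (intro mult_right_mono) auto
  finally show ?case
    using walks_eq by simp
qed

lemma walk_displacement:
  assumes "successively adjacent vs" "vs \<noteq> []"
  shows "fst (last vs) + snd (last vs) < fst (hd vs) + snd (hd vs) + length vs"
  using assms
proof (induction vs rule: induct_list012)
  case (3 u v vs)
  then have "adjacent u v" by simp
  then have "fst v + snd v \<le> Suc (fst u + snd u)" by (auto simp: adjacent_def)
  with 3 show ?case by auto
qed auto

text \<open>A path from the origin to a point at graph distance at least \<open>n\<close> has at least \<open>n + 1\<close> vertices;
  its first \<open>n + 1\<close> vertices form a self-avoiding open walk.\<close>

lemma origin_to_infinity_open_walk:
  "origin_to_infinity \<subseteq> (\<Union>vs\<in>{vs \<in> walks n (0, 0). distinct vs}. {\<omega>. \<forall>w\<in>set vs. \<omega> w})"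
proof
  fix \<omega> assume "\<omega> \<in> origin_to_infinity"
  then obtain v where v: "n \<le> fst v + snd v" "connected_in \<omega> (0, 0) v"
    unfolding origin_to_infinity_eq by blast
  then obtain vs where vs: "vs \<noteq> []" "distinct vs" "successively adjacent vs" "hd vs = (0, 0)"
      "last vs = v" and "open": "\<forall>w\<in>set vs. \<omega> w"
    by (auto simp: connected_in_def lattice_path_def)
  have len: "Suc n \<le> length vs"
    using walk_displacement[of vs] vs v by simp
  have "successively adjacent (take (Suc n) vs @ drop (Suc n) vs)"
    using vs by simp
  then have "successively adjacent (take (Suc n) vs)"
    unfolding successively_append_iff by blast
  then have "take (Suc n) vs \<in> {vs \<in> walks n (0, 0). distinct vs}"
    using vs len by (simp add: walks_def)
  moreover have "\<forall>w\<in>set (take (Suc n) vs). \<omega> w"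
    using "open" by (meson in_set_takeD)
  ultimately show "\<omega> \<in> (\<Union>vs\<in>{vs \<in> walks n (0, 0). distinct vs}. {\<omega>. \<forall>w\<in>set vs. \<omega> w})"
    by blast
qed

text \<open>First moment bound: there are at most \<open>4 ^ n\<close> walks of \<open>n + 1\<close> vertices, and a self-avoiding
  one is open with probability \<open>p ^ (n + 1)\<close>.\<close>

lemma no_percolation_below_quarter:
  assumes "0 \<le> p" "p < 1 / 4"
  shows "percolation_prob {} p p = 0"
proof -
  interpret prob_space "bernoulli_field (\<lambda>_ :: vertex. p)"
    by (rule prob_space_bernoulli_field)
  have bound: "percolation_prob {} p p \<le> p * (4 * p) ^ n" for n
  proof -
    let ?W = "{vs \<in> walks n (0, 0). distinct vs}"
    let ?O = "\<lambda>vs. {\<omega>. \<forall>w\<in>set vs. \<omega> w} :: (vertex \<Rightarrow> bool) set"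
    have W: "finite ?W" "card ?W \<le> 4 ^ n"
      using walks_le[of n "(0, 0)"] card_mono[of "walks n (0, 0)" ?W] by auto
    have O: "?O vs \<in> events" for vs
      unfolding sets_bernoulli_field by (rule sets_all_open) simp
    have "percolation_prob {} p p = prob origin_to_infinity"
      by (simp add: percolation_prob_def percolation_measure_eq_bernoulli_field)
    also have "\<dots> \<le> prob (\<Union>vs\<in>?W. ?O vs)"
      using origin_to_infinity_open_walk W O by (intro finite_measure_mono) auto
    also have "\<dots> \<le> (\<Sum>vs\<in>?W. prob (?O vs))"
      using W O by (intro finite_measure_subadditive_finite) auto
    also have "\<dots> = (\<Sum>vs\<in>?W. p ^ Suc n)"
      using assms
      by (intro sum.cong refl) (simp add: measure_bernoulli_field_all_open walks_def distinct_card)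
    also have "\<dots> = real (card ?W) * p ^ Suc n"
      by simp
    also have "\<dots> \<le> 4 ^ n * p ^ Suc n"
    proof (rule mult_right_mono)
      show "real (card ?W) \<le> 4 ^ n"
        using of_nat_mono[OF W(2), where 'a = real] by simp
      show "0 \<le> p ^ Suc n"
        using assms by simp
    qed
    also have "\<dots> = p * (4 * p) ^ n"
      by (simp add: power_mult_distrib)
    finally show ?thesis .
  qed
  have "(\<lambda>n. p * (4 * p) ^ n) \<longlonglongrightarrow> p * 0"
    using assms by (intro tendsto_mult tendsto_const LIMSEQ_power_zero) auto
  then have "percolation_prob {} p p \<le> 0"
    using bound by (intro LIMSEQ_le_const) auto
  then show ?thesis
    by (simp add: percolation_prob_def measure_le_0_iff)
qed

text \<open>Dilution lowers the parameter of some sites to \<open>p_crit\<close>; if that were 0, closing a single site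
  could destroy percolation for good, and the invariance under finite changes would fail.\<close>

lemma p_crit_pos: "0 < p_crit"
proof -
  have "1 / 8 \<le> p_crit"
    unfolding p_crit_def
    by (rule cSup_upper) (auto simp: no_percolation_below_quarter intro!: bdd_aboveI[of _ 1])
  then show ?thesis by simp
qed

section \<open>Percolation in the diluted environment\<close>

lemma measurable_diluted:
  "(\<lambda>(\<Xi>, D). diluted \<Xi> D) \<in> subset_space \<Otimes>\<^sub>M dilution_law \<phi> \<rightarrow>\<^sub>M subset_space"
proof (rule measurable_into_subset_space)
  fix v
  have "{D. D v} \<in> sets (dilution_law \<phi>)"
    using sets_all_open[of "{v}"] by (simp add: dilution_law_eq_bernoulli_field sets_bernoulli_field)
  then have "{\<Xi>. v \<in> \<Xi>} \<times> {D. D v} \<in> sets (subset_space \<Otimes>\<^sub>M dilution_law \<phi>)"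
    by (intro pair_measureI sets_subset_space_member)
  also have "{\<Xi>. v \<in> \<Xi>} \<times> {D. D v} =
      {w \<in> space (subset_space \<Otimes>\<^sub>M dilution_law \<phi>). v \<in> (case w of (\<Xi>, D) \<Rightarrow> diluted \<Xi> D)}"
    by (auto simp: space_pair_measure diluted_def dilution_law_eq_bernoulli_field)
  finally show "\<dots> \<in> sets (subset_space \<Otimes>\<^sub>M dilution_law \<phi>)" .
qed

lemma measurable_percolation_prob:
  "(\<lambda>A. percolation_prob A p q) \<in> borel_measurable subset_space"
  unfolding percolation_prob_def
  by (rule measurable_compose[OF measurable_prob_algebraD[OF measurable_percolation_measure]
        measurable_measure_subprob_algebra[OF sets_origin_to_infinity]])

lemma percolation_prob_pos_iff:
  "percolation_prob A p q > 0 \<longleftrightarrow> emeasure (percolation_measure A p q) origin_to_infinity \<noteq> 0"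
proof -
  interpret prob_space "percolation_measure A p q"
    unfolding percolation_measure_eq_bernoulli_field by (rule prob_space_bernoulli_field)
  show ?thesis
    by (simp add: percolation_prob_def emeasure_eq_measure zero_less_measure_iff)
qed

lemma percolation_prob_pos_finite_change:
  assumes "0 < p" "p \<le> 1" "0 < q" "q \<le> 1"
    and fin: "finite {v. (v \<in> A) \<noteq> (v \<in> B)}" and pos: "percolation_prob A p q > 0"
  shows "percolation_prob B p q > 0"
proof -
  let ?r = "\<lambda>A v. if v \<in> A then p else q"
  have pos': "emeasure (bernoulli_field (?r A)) origin_to_infinity \<noteq> 0"
    using pos unfolding percolation_prob_pos_iff percolation_measure_eq_bernoulli_field .
  have "emeasure (bernoulli_field (?r B)) origin_to_infinity \<noteq> 0"
  proof (rule increasing_event_positive_finite_change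
      [OF sets_origin_to_infinity increasing_origin_to_infinity _ _ _ pos'])
    show "finite {v. ?r A v \<noteq> ?r B v}"
      using fin by (rule rev_finite_subset) auto
  qed (use assms(1-4) in simp_all)
  then show ?thesis
    unfolding percolation_prob_pos_iff percolation_measure_eq_bernoulli_field .
qed

text \<open>The averaging identity shows that the set of dilutions for which percolation has positive
  probability is not null. It is invariant under finite changes of the dilution, so the
  zero-one law gives it full measure.\<close>

lemma percolation_survives_dilution:
  assumes "0 < p" "p \<le> 1" "0 < q" "q \<le> 1" "\<phi> \<in> {0..1}"
    and pos: "percolation_prob \<Xi> (q + \<phi> * (p - q)) q > 0"
  shows "AE D in dilution_law \<phi>. percolation_prob (diluted \<Xi> D) p q > 0"
proof -
  interpret prob_space "dilution_law \<phi>"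
    unfolding dilution_law_eq_bernoulli_field by (rule prob_space_bernoulli_field)
  let ?T = "{D. percolation_prob (diluted \<Xi> D) p q > 0}"
  have space: "space (dilution_law \<phi>) = UNIV"
    by (simp add: dilution_law_eq_bernoulli_field)
  have "(\<lambda>D. diluted \<Xi> D) \<in> dilution_law \<phi> \<rightarrow>\<^sub>M subset_space"
    using measurable_compose[OF measurable_Pair1'[of \<Xi> subset_space] measurable_diluted] by simp
  then have "(\<lambda>D. percolation_prob (diluted \<Xi> D) p q) \<in> borel_measurable (dilution_law \<phi>)"
    using measurable_percolation_prob by (rule measurable_compose)
  then have "{D \<in> space (dilution_law \<phi>). 0 < percolation_prob (diluted \<Xi> D) p q} \<in> events"
    by measurable
  then have T: "?T \<in> events" by (simp add: space)
  have "prob ?T = 0 \<or> prob ?T = 1"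
    unfolding dilution_law_def
  proof (rule finite_change_zero_one_law[OF measure_pmf.prob_space_axioms bij_prod_decode])
    show "?T \<in> sets (PiM UNIV (\<lambda>_. measure_pmf (bernoulli_pmf \<phi>)))"
      using T by (simp add: dilution_law_def)
    fix D D' :: "vertex \<Rightarrow> bool" assume "D \<in> ?T" and fin: "finite {v. D v \<noteq> D' v}"
    moreover have "finite {v. (v \<in> diluted \<Xi> D) \<noteq> (v \<in> diluted \<Xi> D')}"
      using fin by (rule rev_finite_subset) (auto simp: diluted_def)
    ultimately show "D' \<in> ?T"
      using percolation_prob_pos_finite_change assms(1-4) by blast
  qed
  \<comment> \<open>Otherwise the average over the dilution, which is positive by assumption, would vanish.\<close>
  moreover have "prob ?T \<noteq> 0"
  proof
    assume "prob ?T = 0"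
    then have "AE D in dilution_law \<phi>. D \<notin> ?T"
      using T by (simp add: prob_eq_0)
    then have "(\<integral>\<^sup>+D. emeasure (percolation_measure (diluted \<Xi> D) p q) origin_to_infinity
        \<partial>dilution_law \<phi>) = (\<integral>\<^sup>+D. 0 \<partial>dilution_law \<phi>)"
      by (intro nn_integral_cong_AE) (simp add: percolation_prob_pos_iff)
    then have "emeasure (percolation_measure \<Xi> (q + \<phi> * (p - q)) q) origin_to_infinity = 0"
      using percolation_measure_average_dilution[OF _ _ _ sets_origin_to_infinity, of \<phi> p q \<Xi>] assms
      by simp
    with pos show False by (simp add: percolation_prob_pos_iff)
  qed
  ultimately have "prob ?T = 1" by simp
  then show ?thesis
    using AE_prob_1 by fastforce
qed

lemma environment_law_prob_space:
  assumes "prob_space M" "indep_spacings M \<xi> \<eta>"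
  shows "prob_space (environment_law M \<xi> \<eta>)"
proof -
  interpret prob_space M by fact
  have selected: "prob_space (selected_law M \<zeta>)"
    if "(\<lambda>w. \<lambda>k\<in>{1..}. \<zeta> k w) \<in> M \<rightarrow>\<^sub>M PiM {1..} (\<lambda>_. count_space UNIV)" for \<zeta> :: "nat \<Rightarrow> 'a \<Rightarrow> nat"
  proof -
    have "(\<lambda>w. selected (\<lambda>k\<in>{1..}. \<zeta> k w)) = (\<lambda>w. selected (\<lambda>k. \<zeta> k w))"
      by (rule ext, rule selected_cong) simp
    with measurable_compose[OF that measurable_selected] show ?thesis
      unfolding selected_law_def by (intro prob_space_distr) simp
  qed
  note indep = assms(2)[unfolded indep_spacings_def]
  interpret C: prob_space "selected_law M \<xi>"
    by (rule selected[OF indep_var_rv1[OF indep]])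
  interpret R: prob_space "selected_law M \<eta>"
    by (rule selected[OF indep_var_rv2[OF indep]])
  interpret pair_prob_space "selected_law M \<xi>" "selected_law M \<eta>" ..
  have "sets (selected_law M \<xi> \<Otimes>\<^sub>M selected_law M \<eta>) = sets (subset_space \<Otimes>\<^sub>M subset_space)"
    by (intro sets_pair_measure_cong) (simp_all add: selected_law_def)
  then show ?thesis
    unfolding environment_law_def
    by (intro prob_space_distr) (simp add: measurable_Times_subset_space cong: measurable_cong_sets)
qed

theorem theorem2:
  fixes M :: "'a measure" and \<xi>x \<xi>y :: "nat \<Rightarrow> 'a \<Rightarrow> nat"
  assumes "prob_space M"
    and "iid_spacings M \<xi>x"
    and "iid_spacings M \<xi>y"
    and "indep_spacings M \<xi>x \<xi>y"
    and "\<forall>\<epsilon>\<in>{0<..1 - p_crit}.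
           AE \<Xi> in environment_law M \<xi>x \<xi>y. percolation_prob \<Xi> (p_crit + \<epsilon>) p_crit > 0"
  shows "\<forall>\<phi>\<in>{0<..1}. \<forall>\<epsilon>'\<in>{0<..1 - p_crit}.
           AE (\<Xi>, D) in environment_law M \<xi>x \<xi>y \<Otimes>\<^sub>M dilution_law \<phi>.
             percolation_prob (diluted \<Xi> D) (p_crit + \<epsilon>') p_crit > 0"
proof (intro ballI)
  fix \<phi> \<epsilon>' :: real assume \<phi>: "\<phi> \<in> {0<..1}" and \<epsilon>': "\<epsilon>' \<in> {0<..1 - p_crit}"
  let ?\<mu> = "environment_law M \<xi>x \<xi>y" and ?p = "p_crit + \<epsilon>'"
  interpret E: prob_space ?\<mu>
    using assms by (intro environment_law_prob_space)
  interpret D: prob_space "dilution_law \<phi>"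
    unfolding dilution_law_eq_bernoulli_field by (rule prob_space_bernoulli_field)
  interpret pair_prob_space ?\<mu> "dilution_law \<phi>" ..
  \<comment> \<open>The averaged excess of the diluted model over \<open>p_crit\<close> is \<open>\<phi> * \<epsilon>'\<close>, so the hypothesis is
    used at \<open>\<epsilon> = \<phi> * \<epsilon>'\<close>.\<close>
  have "\<phi> * \<epsilon>' \<le> \<epsilon>'"
    using \<phi> \<epsilon>' by (simp add: mult_left_le_one_le)
  then have "\<phi> * \<epsilon>' \<le> 1 - p_crit"
    using \<epsilon>' by (meson greaterThanAtMost_iff order_trans)
  then have "\<phi> * \<epsilon>' \<in> {0<..1 - p_crit}"
    using \<phi> \<epsilon>' by simp
  with assms(5) have "AE \<Xi> in ?\<mu>. percolation_prob \<Xi> (p_crit + \<phi> * \<epsilon>') p_crit > 0"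
    by blast
  then have quenched: "AE \<Xi> in ?\<mu>. AE D in dilution_law \<phi>.
      percolation_prob (diluted \<Xi> D) ?p p_crit > 0"
  proof eventually_elim
    case (elim \<Xi>)
    show ?case
    proof (rule percolation_survives_dilution)
      show "0 < percolation_prob \<Xi> (p_crit + \<phi> * (?p - p_crit)) p_crit"
        using elim by simp
      show "0 < ?p" "?p \<le> 1" "0 < p_crit" "p_crit \<le> 1" "\<phi> \<in> {0..1}"
        using \<phi> \<epsilon>' p_crit_pos by simp_all
    qed
  qed
  \<comment> \<open>Passing from iterated almost sure statements to the product measure requires joint measurability.\<close>
  have "sets (?\<mu> \<Otimes>\<^sub>M dilution_law \<phi>) = sets (subset_space \<Otimes>\<^sub>M dilution_law \<phi>)"
    by (intro sets_pair_measure_cong) (simp_all add: environment_law_def)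
  then have "(\<lambda>(\<Xi>, D). diluted \<Xi> D) \<in> ?\<mu> \<Otimes>\<^sub>M dilution_law \<phi> \<rightarrow>\<^sub>M subset_space"
    using measurable_diluted by (simp cong: measurable_cong_sets)
  from measurable_compose[OF this measurable_percolation_prob]
  have "(\<lambda>(\<Xi>, D). percolation_prob (diluted \<Xi> D) ?p p_crit) \<in> borel_measurable (?\<mu> \<Otimes>\<^sub>M dilution_law \<phi>)"
    by (simp add: split_beta)
  then have "{x \<in> space (?\<mu> \<Otimes>\<^sub>M dilution_law \<phi>).
      0 < (case x of (\<Xi>, D) \<Rightarrow> percolation_prob (diluted \<Xi> D) ?p p_crit)}
      \<in> sets (?\<mu> \<Otimes>\<^sub>M dilution_law \<phi>)"
    by measurable
  from AE_pair_measure[OF this] quenched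
  show "AE (\<Xi>, D) in ?\<mu> \<Otimes>\<^sub>M dilution_law \<phi>. percolation_prob (diluted \<Xi> D) ?p p_crit > 0"
    by (simp add: split_beta)
qed

end
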